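(* Let $R$ be a unital ring with involution $*$, let $a\in R$ and let $n$ be a positive integer. Then the following conditions are equivalent: (1) $a\in R^{\dagger}$; (2) there exists a projection $q\in R$ such that $qa=0$ and $(aa^{*})^{n}+q$ is invertible; (3) there exists a projection $q\in R$ such that $qa=0$ and $(aa^{*})^{n}+q$ is left invertible; (4) there exists an idempotent $f\in R$ such that $fa=0$ and $(aa^{*})^{n}+f$ is invertible; (5) there exists an idempotent $f\in R$ such that $fa=0$ and $(aa^{*})^{n}+f$ is left invertible; (6) there exists $c\in R$ such that $ca=0$ and $(aa^{*})^{n}+c$ is invertible; (7) there exists $c\in R$ such that $ca=0$ and $(aa^{*})^{n}+c$ is left invertible. In this case, $a^{\dagger}=a^{*}y_{i}(aa^{*})^{2n-1}y_{i}^{*}$ for $i\in\{1,2,3\}$, where $y_1,y_2,y_3\in R$ satisfy $1=y_{1}((aa^{*})^{n}+q)=y_{2}((aa^{*})^{n}+f)=y_{3}((aa^{*})^{n}+c)$, with $q$, $f$, $c$ as in (3), (5), (7) respectively.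
   Context: $R$ is a unital ring with an involution $a\mapsto a^*$, i.e. $(a^* )^*=a$, $(ab)^*=b^*a^*$, $(a+b)^*=a^*+b^*$. $b$ is the Moore-Penrose inverse of $a$ if $aba=a$, $bab=b$, $(ab)^*=ab$, $(ba)^*=ba$; it is unique if it exists and is denoted $a^{\dagger}$; $R^{\dagger}$ is the set of Moore-Penrose invertible elements. A projection is an element $p$ with $p^2=p=p^*$; an idempotent is an element $f$ with $f^2=f$. An element $z$ is left invertible if $yz=1$ for some $y\in R$. *)

theory Defs
  imports Main
begin

text \<open>
  The sort \<open>{ring, monoid_mult}\<close> rather than \<open>ring_1\<close> is used because the latter requires
  \<open>0 \<noteq> 1\<close> and would exclude the zero ring.
\<close>

class unital_star_ring = ring + monoid_mult +
  fixes star :: "'a \<Rightarrow> 'a"  (\<open>_\<^sup>\<star>\<close> [1000] 999)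
  assumes star_star [simp]: "(a\<^sup>\<star>)\<^sup>\<star> = a"
    and star_mult: "(a * b)\<^sup>\<star> = b\<^sup>\<star> * a\<^sup>\<star>"
    and star_add: "(a + b)\<^sup>\<star> = a\<^sup>\<star> + b\<^sup>\<star>"

definition is_mp_inverse :: "'a::unital_star_ring \<Rightarrow> 'a \<Rightarrow> bool" where
  "is_mp_inverse a b \<longleftrightarrow>
     a * b * a = a \<and> b * a * b = b \<and> (a * b)\<^sup>\<star> = a * b \<and> (b * a)\<^sup>\<star> = b * a"

definition mp_invertibles :: "'a::unital_star_ring set"  (\<open>R\<^sup>\<dagger>\<close>) where
  "mp_invertibles = {a. \<exists>b. is_mp_inverse a b}"

text \<open>Only meaningful for Moore-Penrose invertible arguments, where \<open>mp_inverse_eqI\<close> below applies.\<close>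

definition mp_inverse :: "'a::unital_star_ring \<Rightarrow> 'a"  (\<open>_\<^sup>\<dagger>\<close> [1000] 999) where
  "a\<^sup>\<dagger> = (THE b. is_mp_inverse a b)"

definition projection :: "'a::unital_star_ring \<Rightarrow> bool" where
  "projection p \<longleftrightarrow> p ^ 2 = p \<and> p = p\<^sup>\<star>"

definition idempotent_elem :: "'a::monoid_mult \<Rightarrow> bool" where
  "idempotent_elem f \<longleftrightarrow> f ^ 2 = f"

definition left_invertible_elem :: "'a::monoid_mult \<Rightarrow> bool" where
  "left_invertible_elem z \<longleftrightarrow> (\<exists>y. y * z = 1)"

definition invertible_elem :: "'a::monoid_mult \<Rightarrow> bool" where
  "invertible_elem z \<longleftrightarrow> (\<exists>y. y * z = 1 \<and> z * y = 1)"

lemma is_mp_inverse_unique: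
  fixes a b c :: "'a::unital_star_ring"
  assumes "is_mp_inverse a b" and "is_mp_inverse a c"
  shows "b = c"
proof -
  note b = assms(1)[unfolded is_mp_inverse_def] and c = assms(2)[unfolded is_mp_inverse_def]
  have "a * b = (a * c) * (a * b)"
    using c by (simp add: mult.assoc[symmetric])
  also have "\<dots> = (a * c)\<^sup>\<star> * (a * b)\<^sup>\<star>"
    using b c by simp
  also have "\<dots> = ((a * b) * (a * c))\<^sup>\<star>"
    by (simp only: star_mult)
  also have "(a * b) * (a * c) = a * c"
    using b by (simp add: mult.assoc[symmetric])
  finally have ab: "a * b = a * c"
    using c by simp
  have "b * a = (b * a) * (c * a)"
    using c by (metis mult.assoc)
  also have "\<dots> = (b * a)\<^sup>\<star> * (c * a)\<^sup>\<star>"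
    using b c by simp
  also have "\<dots> = ((c * a) * (b * a))\<^sup>\<star>"
    by (simp only: star_mult)
  also have "(c * a) * (b * a) = c * a"
    using b by (metis mult.assoc)
  finally have ba: "b * a = c * a"
    using c by simp
  have "b = b * a * b" using b by simp
  also have "\<dots> = c * (a * b)" by (simp add: ba mult.assoc)
  also have "\<dots> = c" using c by (simp add: ab mult.assoc)
  finally show ?thesis .
qed

lemma mp_inverse_eqI:
  fixes a b :: "'a::unital_star_ring"
  assumes "is_mp_inverse a b"
  shows "a\<^sup>\<dagger> = b"
  unfolding mp_inverse_def using assms is_mp_inverse_unique by blast

end

theory Submission imports Defs begin

text \<open>
  Put \<open>u = a a\<^sup>\<star>\<close>.

  If \<open>a\<close> is Moore-Penrose invertible, then \<open>p = a a\<^sup>\<dagger>\<close> is a projection, and \<open>u\<close> is invertible in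
  the corner ring \<open>p R p\<close>, with inverse \<open>v = (a\<^sup>\<dagger>)\<^sup>\<star> a\<^sup>\<dagger>\<close>. Hence \<open>u\<^sup>n\<close> has the inverse \<open>v\<^sup>n\<close> in that
  corner, and adding the complementary projection \<open>q = 1 - p\<close>, which annihilates \<open>a\<close> from the left,
  gives a unit of \<open>R\<close> with inverse \<open>v\<^sup>n + q\<close> (\<open>complement_of_range_projection\<close>). So the
  strongest condition (a projection and two-sided invertibility) holds.

  Conversely, the weakest condition, \<open>1 = y (u\<^sup>n + c)\<close> with \<open>c a = 0\<close>, is used only through its
  consequence \<open>a = y u\<^sup>n a\<close>. This forces \<open>y u\<^sup>n\<close> to be self-adjoint
  (\<open>left_quotient_hermitian\<close>), hence the projection onto the range of \<open>a\<close>, and with it the displayed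
  formula can be checked directly against the four Penrose equations
  (\<open>mp_inverse_of_left_quotient\<close>). Since projections are idempotents and units are left
  invertible, every other condition lies between these two, and the same computation yields all
  three formulas.
\<close>

lemma star_one: "(1::'a::unital_star_ring)\<^sup>\<star> = 1"
  using star_mult[of "(1::'a)\<^sup>\<star>" 1] by simp

lemma star_diff: "((a::'a::unital_star_ring) - b)\<^sup>\<star> = a\<^sup>\<star> - b\<^sup>\<star>"
  using star_add[of "a - b" b] by (simp add: eq_diff_eq)

lemma star_power: "((a::'a::unital_star_ring) ^ n)\<^sup>\<star> = a\<^sup>\<star> ^ n"
  by (induction n) (simp_all add: star_one star_mult power_commutes)

lemma star_gram: "((a::'a::unital_star_ring) * a\<^sup>\<star>)\<^sup>\<star> = a * a\<^sup>\<star>"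
  by (simp add: star_mult)

text \<open>
  In \<open>u\<^sup>m\<^sup>+\<^sup>1 v\<^sup>m\<^sup>+\<^sup>1\<close> the innermost product \<open>u v = p\<close> is absorbed by the next factor \<open>v\<close>. The
  exponent must be positive because \<open>u ^ 0\<close> is the unit of the whole ring.
\<close>

lemma corner_inverse_power:
  fixes u v p :: "'a::monoid_mult"
  assumes "u * v = p" and "p * v = v"
  shows "u ^ Suc m * v ^ Suc m = p"
proof (induction m)
  case 0
  then show ?case using assms by simp
next
  case (Suc m)
  have "u ^ Suc (Suc m) * v ^ Suc (Suc m) = u ^ Suc m * ((u * v) * v ^ Suc m)"
    by (simp only: power_Suc2[of u "Suc m"] power_Suc[of v "Suc m"] mult.assoc)
  also have "(u * v) * v ^ Suc m = v ^ Suc m"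
    using assms by (simp add: mult.assoc[symmetric])
  finally show ?case using Suc by simp
qed

lemma unit_of_corner_inverses:
  fixes u v p :: "'a::{ring,monoid_mult}"
  assumes "u * v = p" and "u * p = u" and "p * v = v" and "p * p = p"
  shows "(u ^ Suc m + (1 - p)) * (v ^ Suc m + (1 - p)) = 1"
proof -
  have 1: "u ^ Suc m * v ^ Suc m = p"
    using corner_inverse_power assms by blast
  have 2: "u ^ Suc m * p = u ^ Suc m"
    using assms by (simp only: power_Suc2 mult.assoc)
  have 3: "p * v ^ Suc m = v ^ Suc m"
    using assms by (simp only: power_Suc mult.assoc[symmetric])
  show ?thesis
    by (simp only: distrib_left distrib_right left_diff_distrib right_diff_distrib 1 2 3 assms(4)
        mult_1_left mult_1_right) simp
qed

text \<open>
  The element \<open>(a\<^sup>\<dagger>)\<^sup>\<star> a\<^sup>\<dagger>\<close> is the Moore-Penrose inverse of \<open>a a\<^sup>\<star>\<close>. Both products of the two equal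
  the range projection \<open>a a\<^sup>\<dagger>\<close>, so they are mutually inverse in its corner ring.
\<close>

lemma complement_of_range_projection:
  fixes a b :: "'a::unital_star_ring"
  assumes "is_mp_inverse a b" and "n > 0"
  shows "projection (1 - a * b)" and "(1 - a * b) * a = 0"
    and "invertible_elem ((a * a\<^sup>\<star>) ^ n + (1 - a * b))"
proof -
  have aba: "a * b * a = a" and bab: "b * a * b = b"
    and ab: "(a * b)\<^sup>\<star> = a * b" and ba: "(b * a)\<^sup>\<star> = b * a"
    using assms(1) unfolding is_mp_inverse_def by auto
  define u v p where "u = a * a\<^sup>\<star>" and "v = b\<^sup>\<star> * b" and "p = a * b"
  have ab': "b\<^sup>\<star> * a\<^sup>\<star> = a * b" and ba': "a\<^sup>\<star> * b\<^sup>\<star> = b * a"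
    using ab ba by (simp_all add: star_mult)
  have pp: "p * p = p"
    using aba by (simp add: p_def mult.assoc[symmetric])
  have pu: "p * u = u"
    using aba by (simp add: p_def u_def mult.assoc[symmetric])
  have bp: "b * p = b"
    using bab by (simp add: p_def mult.assoc)
  have vp: "v * p = v"
    using bp by (simp add: v_def mult.assoc)
  have ps: "p\<^sup>\<star> = p" and us: "u\<^sup>\<star> = u" and vs: "v\<^sup>\<star> = v"
    using ab by (simp_all add: p_def u_def v_def star_mult)
  have up: "u * p = u" and pv: "p * v = v"
    using arg_cong[OF pu, of star] arg_cong[OF vp, of star] by (simp_all add: star_mult ps us vs)
  have uv: "u * v = p"
  proof -
    have "u * v = a * (a\<^sup>\<star> * b\<^sup>\<star>) * b" by (simp add: u_def v_def mult.assoc)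
    also have "\<dots> = (a * b * a) * b" by (simp add: ba' mult.assoc)
    finally show ?thesis by (simp add: aba p_def)
  qed
  have vu: "v * u = p"
    using arg_cong[OF uv, of star] by (simp add: star_mult ps us vs)
  obtain m where n: "n = Suc m" using assms(2) gr0_implies_Suc by blast
  have "(u ^ n + (1 - p)) * (v ^ n + (1 - p)) = 1" and "(v ^ n + (1 - p)) * (u ^ n + (1 - p)) = 1"
    unfolding n using unit_of_corner_inverses[OF uv up pv pp] unit_of_corner_inverses[OF vu vp pu pp]
    by blast+
  then show "invertible_elem ((a * a\<^sup>\<star>) ^ n + (1 - a * b))"
    unfolding invertible_elem_def u_def[symmetric] p_def[symmetric] by blast
  show "projection (1 - a * b)"
    unfolding projection_def p_def[symmetric]
    by (simp add: power2_eq_square left_diff_distrib right_diff_distrib pp star_diff star_one ps)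
  show "(1 - a * b) * a = 0"
    by (simp add: left_diff_distrib aba)
qed

text \<open>
  The hypothesis lets \<open>y u\<^sup>n\<close> act as a left identity on \<open>a\<close>, hence on \<open>u\<^sup>n\<close>. Consequently
  \<open>y u\<^sup>n = y (u\<^sup>n)\<^sup>\<star> = y (y u\<^sup>n u\<^sup>n)\<^sup>\<star> = y u\<^sup>n u\<^sup>n y\<^sup>\<star> = u\<^sup>n y\<^sup>\<star>\<close>; the two ends are adjoints of each
  other, so both are self-adjoint.
\<close>

lemma left_quotient_hermitian:
  fixes a y :: "'a::unital_star_ring"
  assumes "y * (a * a\<^sup>\<star>) ^ n * a = a" and "n > 0"
  shows "(a * a\<^sup>\<star>) ^ n * y\<^sup>\<star> = y * (a * a\<^sup>\<star>) ^ n"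
proof -
  obtain m where n: "n = Suc m" using assms(2) gr0_implies_Suc by blast
  define u w where "u = a * a\<^sup>\<star>" and "w = u ^ n"
  have ws: "w\<^sup>\<star> = w"
    by (simp add: w_def u_def star_power star_gram)
  have "y * w * u = u"
    using assms(1) by (simp add: w_def u_def mult.assoc[symmetric])
  then have yww: "y * w * w = w"
    by (simp add: w_def n mult.assoc[symmetric])
  have "w * (w * y\<^sup>\<star>) = w"
    using arg_cong[OF yww, of star] by (simp add: star_mult ws mult.assoc)
  then have "y * w = (y * w * w) * y\<^sup>\<star>"
    by (simp add: mult.assoc)
  then show ?thesis
    using yww by (simp add: w_def u_def)
qed

text \<open>
  Write \<open>p = u\<^sup>n y\<^sup>\<star> = y u\<^sup>n\<close> for the range projection of \<open>a\<close> and \<open>b\<close> for the claimed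
  inverse. The identity \<open>a b = p\<close> comes from splitting \<open>u\<^sup>2\<^sup>n\<^sup>-\<^sup>1\<close> as \<open>u\<^sup>n u\<^sup>n\<^sup>-\<^sup>1\<close>, and \<open>b p = b\<close> from splitting it as \<open>u\<^sup>n\<^sup>-\<^sup>1 u\<^sup>n\<close>. The
  formula for \<open>b\<close> is chosen so that \<open>b a\<close> has the manifestly self-adjoint shape \<open>x u\<^sup>2\<^sup>n\<^sup>-\<^sup>1 x\<^sup>\<star>\<close> with
  \<open>x = a\<^sup>\<star> y\<close>.
\<close>

lemma mp_inverse_of_left_quotient:
  fixes a y :: "'a::unital_star_ring"
  assumes "y * (a * a\<^sup>\<star>) ^ n * a = a" and "n > 0"
  shows "is_mp_inverse a (a\<^sup>\<star> * y * (a * a\<^sup>\<star>) ^ (2 * n - 1) * y\<^sup>\<star>)"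
proof -
  obtain m where n: "n = Suc m" using assms(2) gr0_implies_Suc by blast
  define u p where "u = a * a\<^sup>\<star>" and "p = y * u ^ n"
  define b where "b = a\<^sup>\<star> * y * u ^ (2 * n - 1) * y\<^sup>\<star>"
  have p_alt: "p = u ^ n * y\<^sup>\<star>"
    using left_quotient_hermitian[OF assms] by (simp add: p_def u_def)
  have us: "u\<^sup>\<star> = u"
    by (simp add: u_def star_gram)
  have ps: "p\<^sup>\<star> = p"
    using p_alt by (simp add: p_def star_mult star_power us)
  have pa: "p * a = a"
    using assms(1) by (simp add: p_def u_def)
  then have pu: "p * u = u"
    by (simp add: u_def mult.assoc[symmetric])
  have up: "u * p = u"
    using arg_cong[OF pu, of star] by (simp add: star_mult ps us)
  have pp: "p * p = p"
  proof -
    have "p * u ^ n = u ^ n"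
      using pu by (simp add: n mult.assoc[symmetric])
    then show ?thesis by (simp add: p_alt mult.assoc[symmetric])
  qed
  have split: "u ^ (2 * n - 1) = u ^ n * u ^ m" "u ^ (2 * n - 1) = u ^ m * u ^ n"
    by (simp_all only: n power_add[symmetric]) (simp_all add: mult_2)
  have b_alt: "b = a\<^sup>\<star> * y * u ^ m * p"
    unfolding b_def split(2) p_alt by (simp add: mult.assoc)
  have ab: "a * b = p"
  proof -
    have "a * b = u * (y * u ^ n) * u ^ m * y\<^sup>\<star>"
      unfolding b_def split(1) by (simp add: u_def mult.assoc)
    also have "\<dots> = u ^ n * y\<^sup>\<star>"
      by (simp only: p_def[symmetric] up) (simp add: n)
    finally show ?thesis by (simp add: p_alt)
  qed
  have "(b * a)\<^sup>\<star> = b * a"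
    by (simp add: b_def star_mult star_power us mult.assoc)
  moreover have "b * a * b = b"
    by (simp add: mult.assoc ab) (simp add: b_alt mult.assoc pp)
  ultimately have "is_mp_inverse a b"
    unfolding is_mp_inverse_def by (simp add: ab pa ps)
  then show ?thesis by (simp add: b_def u_def)
qed

lemma mp_inverse_of_left_inverse:
  fixes a c y :: "'a::unital_star_ring"
  assumes "c * a = 0" and "1 = y * ((a * a\<^sup>\<star>) ^ n + c)" and "n > 0"
  shows "is_mp_inverse a (a\<^sup>\<star> * y * (a * a\<^sup>\<star>) ^ (2 * n - 1) * y\<^sup>\<star>)"
proof (rule mp_inverse_of_left_quotient[OF _ assms(3)])
  have "a = y * ((a * a\<^sup>\<star>) ^ n + c) * a"
    using assms(2) by simp
  also have "\<dots> = y * (a * a\<^sup>\<star>) ^ n * a + y * (c * a)"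
    by (simp add: distrib_left distrib_right mult.assoc)
  finally show "y * (a * a\<^sup>\<star>) ^ n * a = a"
    using assms(1) by simp
qed

theorem theorem3p6:
  fixes a :: "'a::unital_star_ring" and n :: nat
  assumes "n > 0"
  shows
    "(a \<in> R\<^sup>\<dagger> \<longleftrightarrow>
        (\<exists>q. projection q \<and> q * a = 0 \<and> invertible_elem ((a * a\<^sup>\<star>) ^ n + q))) \<and>
     (a \<in> R\<^sup>\<dagger> \<longleftrightarrow>
        (\<exists>q. projection q \<and> q * a = 0 \<and> left_invertible_elem ((a * a\<^sup>\<star>) ^ n + q))) \<and>
     (a \<in> R\<^sup>\<dagger> \<longleftrightarrow>
        (\<exists>f. idempotent_elem f \<and> f * a = 0 \<and> invertible_elem ((a * a\<^sup>\<star>) ^ n + f))) \<and>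
     (a \<in> R\<^sup>\<dagger> \<longleftrightarrow>
        (\<exists>f. idempotent_elem f \<and> f * a = 0 \<and> left_invertible_elem ((a * a\<^sup>\<star>) ^ n + f))) \<and>
     (a \<in> R\<^sup>\<dagger> \<longleftrightarrow>
        (\<exists>c. c * a = 0 \<and> invertible_elem ((a * a\<^sup>\<star>) ^ n + c))) \<and>
     (a \<in> R\<^sup>\<dagger> \<longleftrightarrow>
        (\<exists>c. c * a = 0 \<and> left_invertible_elem ((a * a\<^sup>\<star>) ^ n + c))) \<and>
     (\<forall>q y\<^sub>1. projection q \<and> q * a = 0 \<and> 1 = y\<^sub>1 * ((a * a\<^sup>\<star>) ^ n + q) \<longrightarrow>
        a\<^sup>\<dagger> = a\<^sup>\<star> * y\<^sub>1 * (a * a\<^sup>\<star>) ^ (2 * n - 1) * y\<^sub>1\<^sup>\<star>) \<and>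
     (\<forall>f y\<^sub>2. idempotent_elem f \<and> f * a = 0 \<and> 1 = y\<^sub>2 * ((a * a\<^sup>\<star>) ^ n + f) \<longrightarrow>
        a\<^sup>\<dagger> = a\<^sup>\<star> * y\<^sub>2 * (a * a\<^sup>\<star>) ^ (2 * n - 1) * y\<^sub>2\<^sup>\<star>) \<and>
     (\<forall>c y\<^sub>3. c * a = 0 \<and> 1 = y\<^sub>3 * ((a * a\<^sup>\<star>) ^ n + c) \<longrightarrow>
        a\<^sup>\<dagger> = a\<^sup>\<star> * y\<^sub>3 * (a * a\<^sup>\<star>) ^ (2 * n - 1) * y\<^sub>3\<^sup>\<star>)"
proof -
  let ?z = "\<lambda>c. (a * a\<^sup>\<star>) ^ n + c"
  have strongest: "\<exists>q. projection q \<and> q * a = 0 \<and> invertible_elem (?z q)" if mp: "a \<in> R\<^sup>\<dagger>"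
  proof -
    obtain b where "is_mp_inverse a b"
      using mp unfolding mp_invertibles_def by blast
    from complement_of_range_projection[OF this assms] show ?thesis by blast
  qed
  have weakest: "a \<in> R\<^sup>\<dagger>" if ca: "c * a = 0" and z: "left_invertible_elem (?z c)" for c
  proof -
    obtain y where "1 = y * ?z c"
      using z unfolding left_invertible_elem_def by metis
    from mp_inverse_of_left_inverse[OF ca this assms] show ?thesis
      unfolding mp_invertibles_def by blast
  qed
  have formula: "a\<^sup>\<dagger> = a\<^sup>\<star> * y * (a * a\<^sup>\<star>) ^ (2 * n - 1) * y\<^sup>\<star>"
    if "c * a = 0" "1 = y * ?z c" for c y
    using mp_inverse_eqI[OF mp_inverse_of_left_inverse[OF that assms]] .
  have idem: "idempotent_elem q" if "projection q" for q :: 'a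
    using that by (simp add: projection_def idempotent_elem_def)
  have linv: "left_invertible_elem z" if "invertible_elem z" for z :: 'a
    using that by (auto simp: invertible_elem_def left_invertible_elem_def)
  \<comment> \<open>The six conditions differ only in \<open>P\<close> and \<open>Q\<close>, and all lie between the two extremes above.\<close>
  have sandwich: "a \<in> R\<^sup>\<dagger> \<longleftrightarrow> (\<exists>c. P c \<and> c * a = 0 \<and> Q (?z c))"
    if "\<And>c. projection c \<Longrightarrow> P c" "\<And>z. invertible_elem z \<Longrightarrow> Q z"
      "\<And>z. Q z \<Longrightarrow> left_invertible_elem z" for P Q
  proof
    assume "a \<in> R\<^sup>\<dagger>"
    then show "\<exists>c. P c \<and> c * a = 0 \<and> Q (?z c)"
      using strongest that(1,2) by blast
  next
    assume "\<exists>c. P c \<and> c * a = 0 \<and> Q (?z c)"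
    then show "a \<in> R\<^sup>\<dagger>"
      using weakest that(3) by blast
  qed
  note arbitrary = sandwich[where P = "\<lambda>_. True", simplified]
  show ?thesis
    by (intro conjI allI impI;
        (rule sandwich arbitrary; (assumption | erule idem linv))?;
        (elim conjE, rule formula; assumption)?)
qed

end
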